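(* Let $R$ be a lie restriction, $G$ a lie restriction graph for $R$, and $P$ a position of weight two; let $x,y$ be vertices of $G$ with either $x\ne y$ and $P(x)=P(y)=1$, or $x=y$ and $P(x)=2$ (all other values $0$). Then the Seeker wins the Renyi-Ulam game with lie restriction $R$ from $P$ if and only if the Seeker wins the two-string game for $R$ started from the pair of strings corresponding to $x$ and $y$ (two copies of $x$ if $x=y$).
   Context: A lie restriction $R$ is a set of finite binary strings that is prefix-closed and extensible. A lie restriction graph $G$ for $R$ is a directed graph with a designated start vertex, arcs labeled $0$ or $1$, each vertex having one or two outgoing arcs with at most one of each label, such that a binary string lies in $R$ iff it is the label sequence of a directed path in $G$ from the start vertex; a string in $R$ is identified with the endpoint of its path (strings with the same endpoint have the same set of extensions in $R$). A position is a map $P$ from vertices to nonnegative integers with finite support; its weight is $\sum_v P(v)$. $(P_1,P_2)$ is a split of $P$ if there are positions $Q_0,Q_1$ with $P=Q_0+Q_1$, $P_1(v)=\sum Q_0(u)$ over $u$ with a $0$-arc $u\to v$, $P_2(v)=\sum Q_1(u)$ over $u$ with a $1$-arc $u\to v$. A strategy tree for $P$ is a finite rooted binary tree of positions with root $P$, children of each non-leaf forming a split, leaves of weight $0$ or $1$; the Seeker wins (the Renyi-Ulam game) from $P$ iff a strategy tree exists. Two-string game for $R$: the state is two binary strings $u_1,u_2$ (equivalently two vertices of $G$). On each turn the Obscurer appends a letter to one of the two strings of her choice and then the Seeker appends a letter to the other string. The Seeker wins if at some point (after either player's move) one of the two strings is not in $R$ (i.e., a letter is appended at a vertex with no outgoing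 arc of that label); the Obscurer wins if this never happens.
   Formalization: The split is corrected to P_1 = 0-arc image of Q_0 plus 1-arc image of Q_1, and P_2 = 0-arc image of Q_1 plus 1-arc image of Q_0; with the split as given, every position of weight two is a Seeker win and the claim fails when R is all binary strings. *)

theory Defs
  imports "HOL-Library.Multiset" "Graph_Theory.Graph_Theory"
begin

text \<open>Binary letters are booleans: \<open>False\<close> is 0 and \<open>True\<close> is 1. Strings grow at the right end.\<close>

definition lie_restriction :: "bool list set \<Rightarrow> bool" where
  "lie_restriction R \<longleftrightarrow>
     (\<forall>u w. u @ w \<in> R \<longrightarrow> u \<in> R) \<and>
     (\<forall>u\<in>R. \<exists>a. u @ [a] \<in> R)"

text \<open>\<open>string_ends G lab s w v\<close>: the string \<open>w\<close> labels a directed path (arcs and vertices may repeat)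
  from \<open>s\<close> to \<open>v\<close>.\<close>

definition string_ends ::
  "('v, 'e) pre_digraph \<Rightarrow> ('e \<Rightarrow> bool) \<Rightarrow> 'v \<Rightarrow> bool list \<Rightarrow> 'v \<Rightarrow> bool" where
  "string_ends G lab s w v \<longleftrightarrow> (\<exists>p. pre_digraph.awalk G s p v \<and> map lab p = w)"

text \<open>The graph may be infinite; \<open>inj_on\<close> says that a vertex has at most one outgoing arc of each
  label.\<close>

definition lie_restriction_graph ::
  "('v, 'e) pre_digraph \<Rightarrow> ('e \<Rightarrow> bool) \<Rightarrow> 'v \<Rightarrow> bool list set \<Rightarrow> bool" where
  "lie_restriction_graph G lab s R \<longleftrightarrow>
     wf_digraph G \<and> s \<in> verts G \<and>
     (\<forall>v\<in>verts G. card (out_arcs G v) \<in> {1, 2} \<and> inj_on lab (out_arcs G v)) \<and>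
     (\<forall>w. w \<in> R \<longleftrightarrow> (\<exists>v. string_ends G lab s w v))"


text \<open>A position is a finitely supported map from the vertices to the naturals, that is, a multiset of
  vertices; its value at \<open>v\<close> is \<open>count P v\<close> and its weight is \<open>size P\<close>.\<close>

definition position :: "('v, 'e) pre_digraph \<Rightarrow> 'v multiset \<Rightarrow> bool" where
  "position G P \<longleftrightarrow> set_mset P \<subseteq> verts G"

definition inflow ::
  "('v, 'e) pre_digraph \<Rightarrow> ('e \<Rightarrow> bool) \<Rightarrow> bool \<Rightarrow> 'v multiset \<Rightarrow> 'v \<Rightarrow> nat" where
  "inflow G lab a Q v =
     (\<Sum>u | u \<in> set_mset Q \<and> (\<exists>e\<in>arcs G. tail G e = u \<and> head G e = v \<and> lab e = a). count Q u)"

text \<open>The Seeker's question partitions \<open>P\<close> into \<open>Q0 + Q1\<close>. An answer agreeing with a candidate appends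
  0 to its string, an answer contradicting it appends 1. The first answer agrees with \<open>Q0\<close> and
  contradicts \<open>Q1\<close>, the second does the reverse, so each child receives contributions from both parts.
  (With only the \<open>Q0\<close> term in \<open>P1\<close> and only the \<open>Q1\<close> term in \<open>P2\<close>, every position of weight two would
  be won by one question, whatever the restriction.)\<close>

definition is_split ::
  "('v, 'e) pre_digraph \<Rightarrow> ('e \<Rightarrow> bool) \<Rightarrow> 'v multiset \<Rightarrow> 'v multiset \<Rightarrow> 'v multiset \<Rightarrow> bool" where
  "is_split G lab P P1 P2 \<longleftrightarrow>
     (\<exists>Q0 Q1. position G Q0 \<and> position G Q1 \<and> P = Q0 + Q1 \<and>
       (\<forall>v. count P1 v = inflow G lab False Q0 v + inflow G lab True Q1 v) \<and>
       (\<forall>v. count P2 v = inflow G lab False Q1 v + inflow G lab True Q0 v))"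

datatype 'v position_tree =
    Tip "'v multiset"
  | Branch "'v multiset" "'v position_tree" "'v position_tree"

primrec root :: "'v position_tree \<Rightarrow> 'v multiset" where
  "root (Tip P) = P"
| "root (Branch P l r) = P"

primrec strategy_tree ::
  "('v, 'e) pre_digraph \<Rightarrow> ('e \<Rightarrow> bool) \<Rightarrow> 'v position_tree \<Rightarrow> bool" where
  "strategy_tree G lab (Tip P) \<longleftrightarrow> position G P \<and> size P \<le> 1"
| "strategy_tree G lab (Branch P l r) \<longleftrightarrow>
     position G P \<and> is_split G lab P (root l) (root r) \<and>
     strategy_tree G lab l \<and> strategy_tree G lab r"

definition seeker_wins_renyi_ulam ::
  "('v, 'e) pre_digraph \<Rightarrow> ('e \<Rightarrow> bool) \<Rightarrow> 'v multiset \<Rightarrow> bool" where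
  "seeker_wins_renyi_ulam G lab P \<longleftrightarrow> (\<exists>t. root t = P \<and> strategy_tree G lab t)"


text \<open>The two-string game is defined over an abstract representation \<open>'s\<close> of a string: \<open>app p a\<close> appends
  the letter \<open>a\<close>, and \<open>out p\<close> says that the string has left the restriction. This serves both for
  actual strings and for vertices.\<close>

datatype side = First | Second

primrec other :: "side \<Rightarrow> side" where
  "other First = Second"
| "other Second = First"

primrec append_at :: "('s \<Rightarrow> bool \<Rightarrow> 's) \<Rightarrow> side \<Rightarrow> bool \<Rightarrow> 's \<times> 's \<Rightarrow> 's \<times> 's" where
  "append_at app First a s = (app (fst s) a, snd s)"
| "append_at app Second a s = (fst s, app (snd s) a)"

text \<open>A Seeker strategy \<open>\<sigma>\<close> maps the nonempty history of Obscurer moves, the current one last, to the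
  reply letter; \<open>m\<close> is an infinite sequence of Obscurer moves. \<open>after_seeker \<dots> n\<close> is the state after \<open>n\<close>
  full turns and \<open>after_obscurer \<dots> n\<close> the state after the Obscurer's next move.\<close>

primrec after_seeker ::
  "('s \<Rightarrow> bool \<Rightarrow> 's) \<Rightarrow> 's \<times> 's \<Rightarrow> ((side \<times> bool) list \<Rightarrow> bool) \<Rightarrow> (nat \<Rightarrow> side \<times> bool) \<Rightarrow> nat \<Rightarrow> 's \<times> 's"
where
  "after_seeker app s \<sigma> m 0 = s"
| "after_seeker app s \<sigma> m (Suc n) =
     append_at app (other (fst (m n))) (\<sigma> (map m [0..<Suc n]))
       (append_at app (fst (m n)) (snd (m n)) (after_seeker app s \<sigma> m n))"

definition after_obscurer ::
  "('s \<Rightarrow> bool \<Rightarrow> 's) \<Rightarrow> 's \<times> 's \<Rightarrow> ((side \<times> bool) list \<Rightarrow> bool) \<Rightarrow> (nat \<Rightarrow> side \<times> bool) \<Rightarrow> nat \<Rightarrow> 's \<times> 's"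
where
  "after_obscurer app s \<sigma> m n =
     append_at app (fst (m n)) (snd (m n)) (after_seeker app s \<sigma> m n)"

definition some_out :: "('s \<Rightarrow> bool) \<Rightarrow> 's \<times> 's \<Rightarrow> bool" where
  "some_out out s \<longleftrightarrow> out (fst s) \<or> out (snd s)"

definition seeker_wins_game :: "('s \<Rightarrow> bool \<Rightarrow> 's) \<Rightarrow> ('s \<Rightarrow> bool) \<Rightarrow> 's \<times> 's \<Rightarrow> bool" where
  "seeker_wins_game app out s \<longleftrightarrow>
     (\<exists>\<sigma>. \<forall>m. \<exists>n. some_out out (after_obscurer app s \<sigma> m n) \<or>
                   some_out out (after_seeker app s \<sigma> m (Suc n)))"

definition seeker_wins_two_string :: "bool list set \<Rightarrow> bool list \<Rightarrow> bool list \<Rightarrow> bool" where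
  "seeker_wins_two_string R u1 u2 \<longleftrightarrow>
     seeker_wins_game (\<lambda>u a. u @ [a]) (\<lambda>u. u \<notin> R) (u1, u2)"

definition succ_vertex ::
  "('v, 'e) pre_digraph \<Rightarrow> ('e \<Rightarrow> bool) \<Rightarrow> 'v \<Rightarrow> bool \<Rightarrow> 'v option" where
  "succ_vertex G lab v a =
     (if \<exists>e\<in>out_arcs G v. lab e = a
      then Some (head G (THE e. e \<in> out_arcs G v \<and> lab e = a)) else None)"

definition seeker_wins_two_vertex ::
  "('v, 'e) pre_digraph \<Rightarrow> ('e \<Rightarrow> bool) \<Rightarrow> 'v \<Rightarrow> 'v \<Rightarrow> bool" where
  "seeker_wins_two_vertex G lab x y \<longleftrightarrow>
     seeker_wins_game (\<lambda>w a. Option.bind w (\<lambda>v. succ_vertex G lab v a)) (\<lambda>w. w = None) (Some x, Some y)"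

end

theory Submission
  imports Defs
begin

text \<open>Let \<open>x\<^sub>a\<close> denote the vertex reached from \<open>x\<close> along its arc labeled \<open>a\<close>. Up to the order of the
  answers, a question at the position \<open>{x, y}\<close> leads either to \<open>{x\<^sub>0, y\<^sub>0}\<close> and \<open>{x\<^sub>1, y\<^sub>1}\<close> or to
  \<open>{x\<^sub>0, y\<^sub>1}\<close> and \<open>{x\<^sub>1, y\<^sub>0}\<close>. Call \<open>(a, b)\<close> good if the Seeker wins the two-string game from
  \<open>(x\<^sub>a, y\<^sub>b)\<close>. She can answer every Obscurer move at \<open>(x, y)\<close> iff every row and every column of the
  two by two matrix of good pairs is nonzero, which is the case iff the matrix contains one of the two
  permutation matrices, that is, iff one of the two questions is good. Plays of the two-string game
  are infinite, but the game is open for the Seeker, so a winning position is one from which a win can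
  be forced in the inductive sense, and strategy trees match these inductive derivations.\<close>

section \<open>Plays, strategies and forced wins in the abstract game\<close>

lemma after_seeker_cong:
  assumes "\<And>h. h \<noteq> [] \<Longrightarrow> \<sigma> h = \<tau> h"
  shows "after_seeker app s \<sigma> m n = after_seeker app s \<tau> m n"
  by (induction n) (simp_all add: assms)

text \<open>Splits off the first turn, whose move stays at the head of every later history. This
  allows strategies for successor states to be glued.\<close>

lemma after_seeker_Suc_shift:
  "after_seeker app s \<sigma> m (Suc n) =
     after_seeker app (after_seeker app s \<sigma> m 1) (\<lambda>h. \<sigma> (m 0 # h)) (\<lambda>i. m (Suc i)) n"
proof (induction n)
  case 0
  show ?case by simp
next
  case (Suc n)
  have "map m [0..<Suc (Suc n)] = m 0 # map (\<lambda>i. m (Suc i)) [0..<Suc n]"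
    by (metis map_upt_Suc)
  with Suc show ?case
    by (simp only: after_seeker.simps(2))
qed

lemma some_out_append_at:
  assumes "\<And>p a. out p \<Longrightarrow> out (app p a)" and "some_out out s"
  shows "some_out out (append_at app d a s)"
  using assms by (cases d) (auto simp: some_out_def)

text \<open>An absorbing \<open>out\<close> persists through the reply, so it is enough to inspect
  the states between turns, the start included.\<close>

lemma seeker_wins_game_absorbing:
  assumes "\<And>p a. out p \<Longrightarrow> out (app p a)"
  shows "seeker_wins_game app out s \<longleftrightarrow> (\<exists>\<sigma>. \<forall>m. \<exists>n. some_out out (after_seeker app s \<sigma> m n))"
proof -
  have "some_out out (after_seeker app s \<sigma> m (Suc n))"
    if "some_out out (after_obscurer app s \<sigma> m n) \<or> some_out out (after_seeker app s \<sigma> m n)" for \<sigma> m n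
    using that unfolding after_obscurer_def after_seeker.simps(2)
    by (metis assms some_out_append_at)
  then have "(\<exists>n. some_out out (after_obscurer app s \<sigma> m n) \<or> some_out out (after_seeker app s \<sigma> m (Suc n)))
      \<longleftrightarrow> (\<exists>n. some_out out (after_seeker app s \<sigma> m n))" for \<sigma> m
    by blast
  then show ?thesis
    by (simp add: seeker_wins_game_def)
qed

text \<open>A derivation is a well-founded tree branching over the Obscurer's moves; it supports the
  induction that infinite plays do not offer.\<close>

inductive forced_win :: "('s \<Rightarrow> bool \<Rightarrow> 's) \<Rightarrow> ('s \<Rightarrow> bool) \<Rightarrow> 's \<times> 's \<Rightarrow> bool"
  for app :: "'s \<Rightarrow> bool \<Rightarrow> 's" and out :: "'s \<Rightarrow> bool" where
  out: "some_out out s \<Longrightarrow> forced_win app out s"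
| turn: "(\<And>d a. \<exists>b. forced_win app out (append_at app (other d) b (append_at app d a s)))
    \<Longrightarrow> forced_win app out s"

lemma forced_win_imp_strategy:
  assumes "forced_win app out s"
  shows "\<exists>\<sigma>. \<forall>m. \<exists>n. some_out out (after_seeker app s \<sigma> m n)"
  using assms
proof (induction rule: forced_win.induct)
  case (out s)
  then show ?case
    by (metis after_seeker.simps(1))
next
  case (turn s)
  then have "\<forall>mv. \<exists>b \<sigma>. \<forall>m. \<exists>n. some_out out (after_seeker app
      (append_at app (other (fst mv)) b (append_at app (fst mv) (snd mv) s)) \<sigma> m n)"
    by blast
  then obtain \<beta> \<tau> where \<tau>: "\<And>mv m. \<exists>n. some_out out (after_seeker app
      (append_at app (other (fst mv)) (\<beta> mv) (append_at app (fst mv) (snd mv) s)) (\<tau> mv) m n)"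
    by metis
  \<comment> \<open>The opening move is answered by \<open>\<beta>\<close>; then the strategy
    \<open>\<tau>\<close> chosen for that move takes over, with the move removed from the
    history.\<close>
  define \<sigma> where "\<sigma> h = (if tl h = [] then \<beta> (hd h) else \<tau> (hd h) (tl h))" for h
  have "\<exists>n. some_out out (after_seeker app s \<sigma> m n)" for m
  proof -
    let ?s = "after_seeker app s \<sigma> m 1"
    have "?s = append_at app (other (fst (m 0))) (\<beta> (m 0)) (append_at app (fst (m 0)) (snd (m 0)) s)"
      by (simp add: \<sigma>_def)
    with \<tau>[of "m 0"] obtain n
      where "some_out out (after_seeker app ?s (\<tau> (m 0)) (\<lambda>i. m (Suc i)) n)"
      by metis
    moreover have "after_seeker app ?s (\<lambda>h. \<sigma> (m 0 # h)) (\<lambda>i. m (Suc i)) n =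
        after_seeker app ?s (\<tau> (m 0)) (\<lambda>i. m (Suc i)) n"
      by (rule after_seeker_cong) (simp add: \<sigma>_def)
    ultimately show ?thesis
      by (metis after_seeker_Suc_shift)
  qed
  then show ?case by blast
qed

text \<open>Outside \<open>forced_win\<close> the Obscurer has a move that stays outside whatever
  the reply. Repeating such moves against \<open>\<sigma>\<close> gives a play that is never
  out.\<close>

lemma strategy_imp_forced_win:
  assumes "\<And>m. \<exists>n. some_out out (after_seeker app s \<sigma> m n)"
  shows "forced_win app out s"
proof (rule ccontr)
  assume lost: "\<not> forced_win app out s"
  have "\<exists>mv. \<forall>b. \<not> forced_win app out
      (append_at app (other (fst mv)) b (append_at app (fst mv) (snd mv) t))"
    if "\<not> forced_win app out t" for t
    using that forced_win.turn[of app out t] by auto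
  then obtain \<mu> where \<mu>: "\<And>t b. \<not> forced_win app out t \<Longrightarrow> \<not> forced_win app out
      (append_at app (other (fst (\<mu> t))) b (append_at app (fst (\<mu> t)) (snd (\<mu> t)) t))"
    by metis
  \<comment> \<open>The reply of \<open>\<sigma>\<close> depends on the whole history, so the play against \<open>\<sigma>\<close> has to carry it along.\<close>
  define play where "play = rec_nat (s, []) (\<lambda>_ (t, h).
    (append_at app (other (fst (\<mu> t))) (\<sigma> (h @ [\<mu> t])) (append_at app (fst (\<mu> t)) (snd (\<mu> t)) t),
     h @ [\<mu> t]))"
  define m where "m n = \<mu> (fst (play n))" for n
  have play: "play n = (after_seeker app s \<sigma> m n, map m [0..<n])" for n
  proof (induction n)
    case 0
    show ?case by (simp add: play_def)
  next
    case (Suc n)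
    have "m n = \<mu> (after_seeker app s \<sigma> m n)"
      unfolding m_def Suc by simp
    moreover have "play (Suc n) = (\<lambda>(t, h).
        (append_at app (other (fst (\<mu> t))) (\<sigma> (h @ [\<mu> t])) (append_at app (fst (\<mu> t)) (snd (\<mu> t)) t),
         h @ [\<mu> t])) (play n)"
      by (simp add: play_def)
    ultimately show ?case
      by (simp add: Suc)
  qed
  have m: "m n = \<mu> (after_seeker app s \<sigma> m n)" for n
    by (subst m_def) (simp add: play)
  have "\<not> forced_win app out (after_seeker app s \<sigma> m n)" for n
  proof (induction n)
    case 0
    show ?case using lost by simp
  next
    case (Suc n)
    then show ?case using \<mu>[OF Suc] by (simp add: m[symmetric])
  qed
  then show False
    using assms[of m] forced_win.out by blast
qed

lemma seeker_wins_game_iff_forced_win: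
  assumes "\<And>p a. out p \<Longrightarrow> out (app p a)"
  shows "seeker_wins_game app out s \<longleftrightarrow> forced_win app out s"
  using forced_win_imp_strategy strategy_imp_forced_win
  by (metis seeker_wins_game_absorbing[of out app, OF assms])

text \<open>Strategies see only moves, never states, so the same \<open>\<sigma>\<close> and
  \<open>m\<close> drive both games and \<open>f\<close> carries one play to the other.\<close>

lemma seeker_wins_game_hom:
  assumes "\<And>p a. f (app p a) = app' (f p) a" and "\<And>p. out p \<longleftrightarrow> out' (f p)"
  shows "seeker_wins_game app out s \<longleftrightarrow> seeker_wins_game app' out' (map_prod f f s)"
proof -
  have app: "map_prod f f (append_at app d a t) = append_at app' d a (map_prod f f t)" for d a t
    by (cases d; cases t) (simp_all add: assms(1))
  have "map_prod f f (after_seeker app s \<sigma> m n) = after_seeker app' (map_prod f f s) \<sigma> m n" for \<sigma> m n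
    by (induction n) (simp_all add: app)
  moreover from this
  have "map_prod f f (after_obscurer app s \<sigma> m n) = after_obscurer app' (map_prod f f s) \<sigma> m n" for \<sigma> m n
    by (simp add: after_obscurer_def app)
  moreover have "some_out out t \<longleftrightarrow> some_out out' (map_prod f f t)" for t
    by (simp add: some_out_def assms(2))
  ultimately show ?thesis
    by (simp only: seeker_wins_game_def)
qed

text \<open>Take \<open>W True b\<close>. If \<open>W False (\<not> b)\<close> fails, row
  \<open>False\<close> gives \<open>W False b\<close> and column \<open>\<not> b\<close> gives
  \<open>W True (\<not> b)\<close>, the other diagonal.\<close>

lemma rows_and_columns_nonzero_iff:
  fixes W :: "bool \<Rightarrow> bool \<Rightarrow> bool"
  shows "(\<forall>a. \<exists>b. W a b) \<and> (\<forall>b. \<exists>a. W a b) \<longleftrightarrow> (\<exists>a b. W a b \<and> W (\<not> a) (\<not> b))"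
  by (auto simp: all_bool_eq ex_bool_eq)

text \<open>A string that has left the restriction adds no weight to the position.\<close>

fun opt_mset :: "'a option \<Rightarrow> 'a multiset" where
  "opt_mset None = {#}"
| "opt_mset (Some v) = {#v#}"

lemma set_opt_mset [simp]: "set_mset (opt_mset w) = set_option w"
  by (cases w) simp_all

section \<open>Successors and splits in a labelled digraph\<close>

locale labelled_digraph = wf_digraph G
  for G :: "('v, 'e) pre_digraph" +
  fixes lab :: "'e \<Rightarrow> bool"
  assumes inj_lab: "v \<in> verts G \<Longrightarrow> inj_on lab (out_arcs G v)"
begin

lemma succ_vertex_eq_Some_iff:
  assumes "u \<in> verts G"
  shows "succ_vertex G lab u a = Some v \<longleftrightarrow> (\<exists>e\<in>arcs G. tail G e = u \<and> head G e = v \<and> lab e = a)"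
proof (cases "\<exists>e\<in>out_arcs G u. lab e = a")
  case True
  then obtain e where e: "e \<in> out_arcs G u" "lab e = a"
    by blast
  then have uniq: "e' = e" if "e' \<in> out_arcs G u" "lab e' = a" for e'
    using that inj_lab[OF assms] by (auto dest: inj_onD)
  then have "(THE e'. e' \<in> out_arcs G u \<and> lab e' = a) = e"
    using e by blast
  then have "succ_vertex G lab u a = Some (head G e)"
    using True by (simp add: succ_vertex_def)
  then show ?thesis
    using e uniq by (metis in_out_arcs_conv option.inject)
next
  case False
  then show ?thesis
    by (auto simp: succ_vertex_def)
qed

lemma succ_vertex_in_verts:
  assumes "u \<in> verts G" and "succ_vertex G lab u a = Some v"
  shows "v \<in> verts G"
  using assms by (auto simp: succ_vertex_eq_Some_iff)

abbreviation step :: "'v option \<Rightarrow> bool \<Rightarrow> 'v option" where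
  "step w a \<equiv> Option.bind w (\<lambda>v. succ_vertex G lab v a)"

definition step_mset :: "bool \<Rightarrow> 'v multiset \<Rightarrow> 'v multiset" where
  "step_mset a Q = (\<Sum>u\<in>#Q. opt_mset (succ_vertex G lab u a))"

lemma step_mset_simps [simp]:
  "step_mset a {#} = {#}"
  "step_mset a (add_mset u Q) = opt_mset (succ_vertex G lab u a) + step_mset a Q"
  by (simp_all add: step_mset_def)

text \<open>Both sides count the occurrences in \<open>Q\<close> of vertices with an
  \<open>a\<close>-arc to \<open>v\<close>, one grouped by vertex, the other one by one.\<close>

lemma inflow_eq_count:
  assumes "position G Q"
  shows "inflow G lab a Q v = count (step_mset a Q) v"
proof -
  let ?E = "\<lambda>u. \<exists>e\<in>arcs G. tail G e = u \<and> head G e = v \<and> lab e = a"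
  have "count (opt_mset (succ_vertex G lab u a)) v = (if ?E u then 1 else 0)" if "u \<in> verts G" for u
    using succ_vertex_eq_Some_iff[OF that, of a v] by (cases "succ_vertex G lab u a") auto
  then have "count (step_mset a Q) v = size (filter_mset ?E Q)"
    using assms by (induction Q) (auto simp: position_def)
  also have "\<dots> = inflow G lab a Q v"
    by (auto simp: inflow_def size_multiset_overloaded_eq intro!: sum.cong)
  finally show ?thesis by simp
qed

lemma is_split_iff:
  "is_split G lab P P1 P2 \<longleftrightarrow> (\<exists>Q0 Q1. position G Q0 \<and> position G Q1 \<and> P = Q0 + Q1 \<and>
     P1 = step_mset False Q0 + step_mset True Q1 \<and> P2 = step_mset False Q1 + step_mset True Q0)"
  unfolding is_split_def multiset_eq_iff[of P1] multiset_eq_iff[of P2]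
  by (simp add: inflow_eq_count cong: conj_cong)

text \<open>\<open>a\<close> and \<open>b\<close> are the letters that the first answer appends to
  \<open>x\<close> and \<open>y\<close>: \<open>False\<close> for a member of \<open>Q0\<close>,
  \<open>True\<close> for one of \<open>Q1\<close>. The second answer appends the
  complements.\<close>

lemma is_split_pair_iff:
  assumes "x \<in> verts G" and "y \<in> verts G"
  defines "pair a b \<equiv> opt_mset (succ_vertex G lab x a) + opt_mset (succ_vertex G lab y b)"
  shows "is_split G lab {#x, y#} P1 P2 \<longleftrightarrow>
    (\<exists>a b. P1 = pair a b \<and> P2 = pair (\<not> a) (\<not> b))"
proof
  assume "is_split G lab {#x, y#} P1 P2"
  then obtain Q0 Q1 where Q: "{#x, y#} = Q0 + Q1"
    "P1 = step_mset False Q0 + step_mset True Q1" "P2 = step_mset False Q1 + step_mset True Q0"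
    by (auto simp: is_split_iff)
  have "Q0 = {#} \<and> Q1 = {#x, y#} \<or> Q0 = {#x#} \<and> Q1 = {#y#} \<or> Q0 = {#y#} \<and> Q1 = {#x#} \<or>
      Q0 = {#x, y#} \<and> Q1 = {#}"
    using Q(1) by (cases Q0; cases Q1)
      (auto simp: add_eq_conv_ex union_is_single single_is_union add_mset_eq_singleton_iff)
  with Q have "P1 = pair True True \<and> P2 = pair False False \<or> P1 = pair False True \<and> P2 = pair True False \<or>
      P1 = pair True False \<and> P2 = pair False True \<or> P1 = pair False False \<and> P2 = pair True True"
    by (auto simp: pair_def add_ac)
  then show "\<exists>a b. P1 = pair a b \<and> P2 = pair (\<not> a) (\<not> b)"
    by (auto simp: ex_bool_eq)
next
  assume "\<exists>a b. P1 = pair a b \<and> P2 = pair (\<not> a) (\<not> b)"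
  then obtain a b where ab: "P1 = pair a b" "P2 = pair (\<not> a) (\<not> b)"
    by blast
  show "is_split G lab {#x, y#} P1 P2"
    unfolding is_split_iff
    by (rule exI[of _ "(if a then {#} else {#x#}) + (if b then {#} else {#y#})"],
        rule exI[of _ "(if a then {#x#} else {#}) + (if b then {#y#} else {#})"])
      (use assms(1,2) in \<open>auto simp: ab pair_def position_def add_ac\<close>)
qed

section \<open>Forced wins and strategy trees\<close>

abbreviation vertex_win :: "'v option \<times> 'v option \<Rightarrow> bool" where
  "vertex_win \<equiv> forced_win step (\<lambda>w. w = None)"

lemma vertex_win_pair_iff:
  "vertex_win (Some x, Some y) \<longleftrightarrow>
    (\<exists>a b. vertex_win (succ_vertex G lab x a, succ_vertex G lab y b) \<and>
      vertex_win (succ_vertex G lab x (\<not> a), succ_vertex G lab y (\<not> b)))"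
proof -
  let ?W = "\<lambda>a b. vertex_win (succ_vertex G lab x a, succ_vertex G lab y b)"
  have all_side: "(\<forall>d. A d) \<longleftrightarrow> A First \<and> A Second" for A
    by (metis side.exhaust)
  have "vertex_win (Some x, Some y) \<longleftrightarrow> (\<forall>d a. \<exists>b.
      vertex_win (append_at step (other d) b (append_at step d a (Some x, Some y))))"
    by (subst forced_win.simps) (auto simp: some_out_def)
  \<comment> \<open>A move on \<open>First\<close> fixes a row and the reply picks the column; a
    move on \<open>Second\<close> does the reverse.\<close>
  also have "\<dots> \<longleftrightarrow> (\<forall>a. \<exists>b. ?W a b) \<and> (\<forall>b. \<exists>a. ?W a b)"
    unfolding all_side by simp
  also have "\<dots> \<longleftrightarrow> (\<exists>a b. ?W a b \<and> ?W (\<not> a) (\<not> b))"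
    by (rule rows_and_columns_nonzero_iff)
  finally show ?thesis .
qed

text \<open>The induction hypotheses for \<open>turn\<close> put a tree in every row and column, so
  one of the two diagonals provides both children of a question.\<close>

lemma vertex_win_imp_strategy_tree:
  assumes "vertex_win s" and "set_option (fst s) \<subseteq> verts G" and "set_option (snd s) \<subseteq> verts G"
  shows "\<exists>t. root t = opt_mset (fst s) + opt_mset (snd s) \<and> strategy_tree G lab t"
  using assms
proof (induction rule: forced_win.induct)
  case (out s)
  let ?P = "opt_mset (fst s) + opt_mset (snd s)"
  have "strategy_tree G lab (Tip ?P)"
    using out by (cases "fst s"; cases "snd s") (auto simp: some_out_def position_def)
  then show ?case
    by (intro exI[of _ "Tip ?P"]) simp
next
  case (turn s)
  show ?case
  \<comment> \<open>\<open>turn\<close> may also derive a state that is already out; its weight is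
    at most one, so a leaf suffices.\<close>
  proof (cases "fst s = None \<or> snd s = None")
    case True
    let ?P = "opt_mset (fst s) + opt_mset (snd s)"
    have "strategy_tree G lab (Tip ?P)"
      using True turn.prems by (cases "fst s"; cases "snd s") (auto simp: position_def)
    then show ?thesis
      by (intro exI[of _ "Tip ?P"]) simp
  next
    case False
    then obtain x y where s: "s = (Some x, Some y)"
      by (cases s) auto
    with turn.prems have xy: "x \<in> verts G" "y \<in> verts G"
      by auto
    let ?p = "\<lambda>a b. opt_mset (succ_vertex G lab x a) + opt_mset (succ_vertex G lab y b)"
    let ?W = "\<lambda>a b. \<exists>t. root t = ?p a b \<and> strategy_tree G lab t"
    have succ: "set_option (succ_vertex G lab x a) \<subseteq> verts G"
      "set_option (succ_vertex G lab y a) \<subseteq> verts G" for a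
      using xy succ_vertex_in_verts by (auto simp: elem_set)
    have "\<exists>b. ?W a b" for a
      using turn.IH[of First a] succ by (auto simp: s)
    moreover have "\<exists>a. ?W a b" for b
      using turn.IH[of Second b] succ by (auto simp: s)
    ultimately have "\<exists>a b. ?W a b \<and> ?W (\<not> a) (\<not> b)"
      using rows_and_columns_nonzero_iff[of ?W] by blast
    then obtain a b where "?W a b" "?W (\<not> a) (\<not> b)"
      by blast
    then obtain l r where lr: "root l = ?p a b" "root r = ?p (\<not> a) (\<not> b)"
      "strategy_tree G lab l" "strategy_tree G lab r"
      by blast
    have "strategy_tree G lab (Branch {#x, y#} l r)"
      using lr xy is_split_pair_iff[OF xy] by (auto simp: position_def)
    then show ?thesis
      by (intro exI[of _ "Branch {#x, y#} l r"]) (simp add: s)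
  qed
qed

text \<open>A leaf has room for one vertex only, so one of the strings is out. The same can happen
  at a branch, which need not have weight two.\<close>

lemma strategy_tree_imp_vertex_win:
  assumes "strategy_tree G lab t" and "root t = opt_mset p + opt_mset q"
  shows "vertex_win (p, q)"
  using assms
proof (induction t arbitrary: p q)
  case (Tip P)
  then have "p = None \<or> q = None"
    by (cases p; cases q) auto
  then show ?case
    by (auto intro!: forced_win.out simp: some_out_def)
next
  case (Branch P l r)
  show ?case
  proof (cases "p = None \<or> q = None")
    case True
    then show ?thesis
      by (auto intro!: forced_win.out simp: some_out_def)
  next
    case False
    then obtain x y where pq: "p = Some x" "q = Some y"
      by auto
    with Branch.prems have "P = {#x, y#}" "x \<in> verts G" "y \<in> verts G"
      by (auto simp: position_def)
    with Branch.prems(1) obtain a b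
      where "root l = opt_mset (succ_vertex G lab x a) + opt_mset (succ_vertex G lab y b)"
        and "root r = opt_mset (succ_vertex G lab x (\<not> a)) + opt_mset (succ_vertex G lab y (\<not> b))"
      by (auto simp: is_split_pair_iff)
    moreover have "strategy_tree G lab l" "strategy_tree G lab r"
      using Branch.prems(1) by simp_all
    ultimately show ?thesis
      unfolding pq vertex_win_pair_iff using Branch.IH by blast
  qed
qed

lemma seeker_wins_renyi_ulam_iff_two_vertex:
  assumes "x \<in> verts G" and "y \<in> verts G"
  shows "seeker_wins_renyi_ulam G lab {#x, y#} \<longleftrightarrow> seeker_wins_two_vertex G lab x y"
proof -
  have "seeker_wins_two_vertex G lab x y \<longleftrightarrow> vertex_win (Some x, Some y)"
    unfolding seeker_wins_two_vertex_def
    by (rule seeker_wins_game_iff_forced_win) simp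
  also have "\<dots> \<longleftrightarrow> seeker_wins_renyi_ulam G lab {#x, y#}"
    using assms vertex_win_imp_strategy_tree[of "(Some x, Some y)"]
      strategy_tree_imp_vertex_win[of _ "Some x" "Some y"]
    by (auto simp: seeker_wins_renyi_ulam_def add_mset_commute)
  finally show ?thesis ..
qed

section \<open>Strings and their endpoints\<close>

lemma foldl_step_None [simp]: "foldl step None w = None"
  by (induction w) simp_all

text \<open>Labels at a vertex are distinct, so a string determines its path; the fold follows it
  and drops to \<open>None\<close> where an arc is missing.\<close>

lemma string_ends_iff_foldl_step:
  assumes "u \<in> verts G"
  shows "string_ends G lab u w v \<longleftrightarrow> foldl step (Some u) w = Some v"
  using assms
proof (induction w arbitrary: u)
  case Nil
  then show ?case
    by (auto simp: string_ends_def awalk_Nil_iff)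
next
  case (Cons a w)
  have "string_ends G lab u (a # w) v \<longleftrightarrow> (\<exists>e p. awalk u (e # p) v \<and> lab e = a \<and> map lab p = w)"
    unfolding string_ends_def map_eq_Cons_conv by blast
  also have "\<dots> \<longleftrightarrow> (\<exists>e\<in>arcs G. tail G e = u \<and> lab e = a \<and> string_ends G lab (head G e) w v)"
    by (auto simp: string_ends_def awalk_Cons_iff)
  also have "\<dots> \<longleftrightarrow> (\<exists>u'. succ_vertex G lab u a = Some u' \<and> string_ends G lab u' w v)"
    using succ_vertex_eq_Some_iff[OF Cons.prems] by auto
  also have "\<dots> \<longleftrightarrow> (\<exists>u'. succ_vertex G lab u a = Some u' \<and> foldl step (Some u') w = Some v)"
    using Cons succ_vertex_in_verts by blast
  also have "\<dots> \<longleftrightarrow> foldl step (Some u) (a # w) = Some v"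
    by (cases "succ_vertex G lab u a") simp_all
  finally show ?case .
qed

text \<open>Sending a string to its endpoint, or to \<open>None\<close> outside \<open>R\<close>, is
  a homomorphism of the two games.\<close>

lemma seeker_wins_two_string_iff_two_vertex:
  assumes "s \<in> verts G" and R: "\<And>w. w \<in> R \<longleftrightarrow> (\<exists>v. string_ends G lab s w v)"
    and "string_ends G lab s u1 x" and "string_ends G lab s u2 y"
  shows "seeker_wins_two_string R u1 u2 \<longleftrightarrow> seeker_wins_two_vertex G lab x y"
proof -
  let ?f = "foldl step (Some s)"
  have "w \<notin> R \<longleftrightarrow> ?f w = None" for w
    using R string_ends_iff_foldl_step[OF assms(1)] by (cases "?f w") auto
  then have "seeker_wins_two_string R u1 u2 \<longleftrightarrow>
      seeker_wins_game step (\<lambda>w. w = None) (map_prod ?f ?f (u1, u2))"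
    unfolding seeker_wins_two_string_def by (intro seeker_wins_game_hom) simp_all
  then show ?thesis
    using assms string_ends_iff_foldl_step[OF assms(1)] by (simp add: seeker_wins_two_vertex_def)
qed

end

theorem theorem5:
  fixes R :: "bool list set"
    and G :: "('v, 'e) pre_digraph"
    and lab :: "'e \<Rightarrow> bool"
    and s x y :: 'v
    and P :: "'v multiset"
  assumes "lie_restriction R"
    and "lie_restriction_graph G lab s R"
    and "position G P"
    and "size P = 2"
    and "x \<in> verts G" and "y \<in> verts G"
    and "(x \<noteq> y \<and> count P x = 1 \<and> count P y = 1) \<or> (x = y \<and> count P x = 2)"
  shows "(seeker_wins_renyi_ulam G lab P \<longleftrightarrow> seeker_wins_two_vertex G lab x y) \<and>
    (\<forall>u1 u2. string_ends G lab s u1 x \<longrightarrow> string_ends G lab s u2 y \<longrightarrow>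
      (seeker_wins_renyi_ulam G lab P \<longleftrightarrow> seeker_wins_two_string R u1 u2))"
proof -
  interpret labelled_digraph G lab
    using assms(2)
    by (simp add: lie_restriction_graph_def labelled_digraph_def labelled_digraph_axioms_def)
  have "{#x, y#} \<subseteq># P"
    using assms(7) by (auto simp: subseteq_mset_def count_greater_zero_iff[symmetric] simp del: count_greater_zero_iff)
  then have "P = {#x, y#}"
    using assms(4) by (metis mset_subset_size not_less_iff_gr_or_eq size_add_mset size_empty
        subset_mset.le_imp_less_or_eq numeral_2_eq_2)
  then show ?thesis
    using assms(2,5,6) seeker_wins_two_string_iff_two_vertex[of s R]
    by (simp add: lie_restriction_graph_def seeker_wins_renyi_ulam_iff_two_vertex)
qed

end
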